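(* Let $\Phi$ be a field of characteristic zero, let $A$ be a finite-dimensional (not necessarily associative) algebra over $\Phi$ with involution $*\colon A\to A$, and let $d=\dim A$. Then the $*$-codimensions of $A$ satisfy $$c_n^*(A)\le d^{\,n+1}$$ for every integer $n\ge 1$.
   Context: All algebras are over a field $\Phi$ of characteristic zero and are not assumed associative or unital. An involution on $A$ is a $\Phi$-linear map $*\colon A\to A$ with $(a^* )^*=a$ and $(ab)^*=b^*a^*$. Put $A^+=\{a\in A: a^*=a\}$ (symmetric elements) and $A^-=\{b\in A: b^*=-b\}$ (skew-symmetric elements). Let $\Phi\{X,Y\}$ be the free nonassociative algebra over $\Phi$ on the free generators $X\cup Y$, $X=\{x_1,x_2,\ldots\}$, $Y=\{y_1,y_2,\ldots\}$. A polynomial $f(x_1,\ldots,x_m,y_1,\ldots,y_r)\in\Phi\{X,Y\}$ is a $*$-identity of $A$ if $f(a_1,\ldots,a_m,b_1,\ldots,b_r)=0$ for all $a_1,\ldots,a_m\in A^+$ and $b_1,\ldots,b_r\in A^-$. Let $Id^*(A)$ be the set of all $*$-identities of $A$. For $0\le k\le n$ let $P^*_{k,n-k}$ be the space of all multilinear polynomials in $x_1,\ldots,x_k,y_1,\ldots,y_{n-k}$. Define $$c^*_{k,n-k}(A)=\dim\frac{P^*_{k,n-k}}{P^*_{k,n-k}\cap Id^*(A)},\qquad c^*_n(A)=\sum_{k=0}^n\binom nk c^*_{k,n-k}(A).$$ The number $c_n^*(A)$ is called the $n$-th $*$-codimension of $A$. *)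

theory Defs
  imports "HOL.Vector_Spaces" "HOL-Library.Poly_Mapping"
begin

context vector_space
begin

text \<open>
  A set \<open>B\<close> of representatives whose cosets \<open>b + W\<close> form a basis of the quotient \<open>V / W\<close>: a
  linear combination of the cosets vanishes in \<open>V / W\<close> iff the same combination of the
  representatives lies in \<open>W\<close>, and the linear independence below forces distinct elements
  of \<open>B\<close> to have distinct cosets, so that \<open>card B\<close> is the number of elements of the basis.
  As for \<^const>\<open>dim\<close>, the cardinality is \<open>0\<close> for infinite-dimensional quotients.
\<close>

definition quotient_basis :: "'b set \<Rightarrow> 'b set \<Rightarrow> 'b set \<Rightarrow> bool" where
  "quotient_basis V W B \<longleftrightarrow>
     B \<subseteq> V \<and>
     (\<forall>S \<subseteq> B. finite S \<longrightarrow> (\<forall>u. (\<Sum>v\<in>S. u v *s v) \<in> W \<longrightarrow> (\<forall>v\<in>S. u v = 0))) \<and>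
     (\<forall>v\<in>V. \<exists>b\<in>span B. v - b \<in> W)"

definition quotient_dim :: "'b set \<Rightarrow> 'b set \<Rightarrow> nat" where
  "quotient_dim V W = card (SOME B. quotient_basis V W B)"

lemma quotient_basis_extend:
  assumes V: "subspace V" and W: "subspace W" "W \<subseteq> V"
    and C: "C \<subseteq> W" "independent C" "W \<subseteq> span C"
    and B: "quotient_basis V W B"
  shows "independent (B \<union> C)" "B \<inter> C = {}" "span (B \<union> C) = V"
proof -
  have indep: "u v = 0" if "S \<subseteq> B" "finite S" "(\<Sum>v\<in>S. u v *s v) \<in> W" "v \<in> S" for S u v
    using B that unfolding quotient_basis_def by blast
  have BV: "B \<subseteq> V" using B unfolding quotient_basis_def by blast
  show disj: "B \<inter> C = {}"
  proof (rule ccontr)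
    assume "B \<inter> C \<noteq> {}"
    then obtain x where "x \<in> B" "x \<in> C" by blast
    then show False using indep[of "{x}" "\<lambda>_. 1" x] C by auto
  qed
  show "independent (B \<union> C)"
    unfolding independent_explicit_finite_subsets
  proof (intro allI impI ballI)
    fix S u v assume S: "S \<subseteq> B \<union> C" "finite S" and z: "(\<Sum>v\<in>S. u v *s v) = 0" and v: "v \<in> S"
    have "sum f S = sum f (S \<inter> B) + sum f (S \<inter> C)" for f :: "'b \<Rightarrow> 'b"
    proof -
      have "sum f ((S \<inter> B) \<union> (S \<inter> C)) = sum f (S \<inter> B) + sum f (S \<inter> C)"
        by (rule sum.union_disjoint) (use S disj in auto)
      moreover have "(S \<inter> B) \<union> (S \<inter> C) = S" using S by blast
      ultimately show ?thesis by (simp only:)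
    qed
    then have eq: "(\<Sum>v\<in>S \<inter> B. u v *s v) = - (\<Sum>v\<in>S \<inter> C. u v *s v)"
      using z by (simp add: eq_neg_iff_add_eq_0)
    have "(\<Sum>v\<in>S \<inter> C. u v *s v) \<in> W"
      using C by (intro subspace_sum[OF W(1)] subspace_scale[OF W(1)]) auto
    then have "(\<Sum>v\<in>S \<inter> B. u v *s v) \<in> W"
      unfolding eq by (rule subspace_neg[OF W(1)])
    then have uB: "u w = 0" if "w \<in> S \<inter> B" for w
      using indep[of "S \<inter> B" u w] S that by auto
    then have "(\<Sum>v\<in>S \<inter> B. u v *s v) = 0" by simp
    then have "(\<Sum>v\<in>S \<inter> C. u v *s v) = 0" using eq by simp
    then have "u w = 0" if "w \<in> S \<inter> C" for w
      using independentD[OF C(2), of "S \<inter> C" u w] S that by auto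
    then show "u v = 0" using uB v S by blast
  qed
  show "span (B \<union> C) = V"
  proof
    show "span (B \<union> C) \<subseteq> V" by (rule span_minimal[OF _ V]) (use BV C(1) W(2) in blast)
    show "V \<subseteq> span (B \<union> C)"
    proof
      fix v assume "v \<in> V"
      with B have "\<exists>b\<in>span B. v - b \<in> W" by (simp add: quotient_basis_def)
      then obtain b where b: "b \<in> span B" "v - b \<in> W" ..
      have "b \<in> span (B \<union> C)" using span_mono[OF Un_upper1] b(1) by (rule subsetD)
      moreover have "v - b \<in> span (B \<union> C)"
        using span_mono[OF Un_upper2] subsetD[OF C(3) b(2)] by (rule subsetD)
      ultimately have "b + (v - b) \<in> span (B \<union> C)" by (rule span_add)
      then show "v \<in> span (B \<union> C)" by simp
    qed
  qed
qed

lemma quotient_basis_exists: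
  assumes V: "subspace V" and W: "subspace W" "W \<subseteq> V"
  shows "\<exists>B. quotient_basis V W B"
proof -
  obtain C where C: "C \<subseteq> W" "independent C" "W \<subseteq> span C"
    using maximal_independent_subset by blast
  obtain D where D: "C \<subseteq> D" "D \<subseteq> V" "independent D" "V \<subseteq> span D"
    using maximal_independent_subset_extend[of C V] C W by blast
  have "quotient_basis V W (D - C)"
    unfolding quotient_basis_def
  proof (intro conjI allI impI ballI)
    show "D - C \<subseteq> V" using D by blast
  next
    fix S u v assume S: "S \<subseteq> D - C" "finite S" and w: "(\<Sum>v\<in>S. u v *s v) \<in> W" and v: "v \<in> S"
    let ?w = "\<Sum>v\<in>S. u v *s v"
    have "?w \<in> span C" using w C by blast
    then obtain T r where T: "finite T" "T \<subseteq> C" "?w = (\<Sum>a\<in>T. r a *s a)"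
      unfolding span_explicit by blast
    let ?u = "\<lambda>a. if a \<in> S then u a else - r a"
    have disj: "S \<inter> T = {}" using S T by blast
    have "(\<Sum>a\<in>S \<union> T. ?u a *s a) = (\<Sum>a\<in>S. ?u a *s a) + (\<Sum>a\<in>T. ?u a *s a)"
      using S T disj by (intro sum.union_disjoint) auto
    also have "(\<Sum>a\<in>S. ?u a *s a) = ?w" by (rule sum.cong) auto
    also have "(\<Sum>a\<in>T. ?u a *s a) = (\<Sum>a\<in>T. - (r a *s a))"
      by (rule sum.cong) (use disj in auto)
    also have "?w + \<dots> = 0" using T by (simp add: sum_negf)
    finally have "(\<Sum>a\<in>S \<union> T. ?u a *s a) = 0" .
    then have "?u v = 0"
      using independentD[OF D(3), of "S \<union> T" ?u v] S T D v by auto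
    then show "u v = 0" using v by simp
  next
    fix v assume "v \<in> V"
    then have "v \<in> span ((D - C) \<union> C)" using D by (auto simp: Un_absorb2)
    then obtain b c where "v = b + c" "b \<in> span (D - C)" "c \<in> span C"
      unfolding span_Un by blast
    moreover have "span C \<subseteq> W" by (rule span_minimal[OF C(1) W(1)])
    ultimately show "\<exists>b\<in>span (D - C). v - b \<in> W" by (intro bexI[of _ b]) auto
  qed
  then show ?thesis by blast
qed

lemma quotient_dim_plus_dim:
  assumes V: "subspace V" and W: "subspace W" "W \<subseteq> V"
    and fin: "finite F" "V \<subseteq> span F"
  shows "quotient_dim V W + dim W = dim V"
proof -
  define B where "B = (SOME B. quotient_basis V W B)"
  have B: "quotient_basis V W B"
    unfolding B_def using quotient_basis_exists[OF V W] by (rule someI_ex)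
  obtain C where C: "C \<subseteq> W" "independent C" "W \<subseteq> span C" "card C = dim W"
    using basis_exists by blast
  note E = quotient_basis_extend[OF V W C(1-3) B]
  have "B \<union> C \<subseteq> span F" using E(3) fin span_superset[of "B \<union> C"] by blast
  then have "finite (B \<union> C)" using independent_span_bound[OF fin(1) E(1)] by blast
  then have "card (B \<union> C) = card B + card C" using E(2) by (intro card_Un_disjoint) auto
  moreover have "card (B \<union> C) = dim V"
    using dim_eq_card[OF _ E(1), of V] E(3) span_eq_iff[THEN iffD2, OF V] by simp
  ultimately show ?thesis using C by (simp add: quotient_dim_def B_def)
qed

end

locale algebra_with_involution = vector_space scale
  for scale :: "'k::field \<Rightarrow> 'a::ab_group_add \<Rightarrow> 'a" +
  fixes mult :: "'a \<Rightarrow> 'a \<Rightarrow> 'a"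
    and star :: "'a \<Rightarrow> 'a"
  assumes linear_mult_left: "Vector_Spaces.linear scale scale (\<lambda>a. mult a b)"
    and linear_mult_right: "Vector_Spaces.linear scale scale (\<lambda>b. mult a b)"
    and linear_star: "Vector_Spaces.linear scale scale star"
    and star_star: "star (star a) = a"
    and star_mult: "star (mult a b) = mult (star b) (star a)"

definition symmetric_elements :: "('a::ab_group_add \<Rightarrow> 'a) \<Rightarrow> 'a set" where
  "symmetric_elements star = {a. star a = a}"

definition skew_elements :: "('a::ab_group_add \<Rightarrow> 'a) \<Rightarrow> 'a set" where
  "skew_elements star = {b. star b = - b}"

text \<open>
  The generators are indexed from \<open>0\<close>: \<open>Sym i\<close> is \<open>x\<^sub>i\<^sub>+\<^sub>1\<close> and \<open>Skew j\<close> is \<open>y\<^sub>j\<^sub>+\<^sub>1\<close>.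
  Monomials are nonempty bracketed words, since the free algebra has no unit.
\<close>

datatype gen = Sym nat | Skew nat

datatype 'v monomial = Gen 'v | Prod "'v monomial" "'v monomial"

primrec factors :: "'v monomial \<Rightarrow> 'v list" where
  "factors (Gen x) = [x]"
| "factors (Prod s t) = factors s @ factors t"

type_synonym 'k free_algebra = "gen monomial \<Rightarrow>\<^sub>0 'k"

definition free_scale :: "'k::field \<Rightarrow> 'k free_algebra \<Rightarrow> 'k free_algebra" where
  "free_scale c p = Poly_Mapping.map ((*) c) p"

definition free_mult :: "'k::field free_algebra \<Rightarrow> 'k free_algebra \<Rightarrow> 'k free_algebra" where
  "free_mult p q =
     (\<Sum>s\<in>Poly_Mapping.keys p. \<Sum>t\<in>Poly_Mapping.keys q.
        Poly_Mapping.single (Prod s t) (Poly_Mapping.lookup p s * Poly_Mapping.lookup q t))"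

lemma lookup_free_scale [simp]:
  "Poly_Mapping.lookup (free_scale c p) w = c * Poly_Mapping.lookup p w"
  by (simp add: free_scale_def Poly_Mapping.map.rep_eq when_def)

lemma vector_space_free_scale: "vector_space (free_scale :: 'k::field \<Rightarrow> _)"
  by unfold_locales (auto intro!: poly_mapping_eqI simp: lookup_add algebra_simps)

primrec eval_monomial :: "('a \<Rightarrow> 'a \<Rightarrow> 'a) \<Rightarrow> ('v \<Rightarrow> 'a) \<Rightarrow> 'v monomial \<Rightarrow> 'a" where
  "eval_monomial mult \<phi> (Gen x) = \<phi> x"
| "eval_monomial mult \<phi> (Prod s t) = mult (eval_monomial mult \<phi> s) (eval_monomial mult \<phi> t)"

definition eval_poly ::
  "('k::field \<Rightarrow> 'a::ab_group_add \<Rightarrow> 'a) \<Rightarrow> ('a \<Rightarrow> 'a \<Rightarrow> 'a) \<Rightarrow> (gen \<Rightarrow> 'a)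
    \<Rightarrow> 'k free_algebra \<Rightarrow> 'a" where
  "eval_poly scale mult \<phi> f =
     (\<Sum>w\<in>Poly_Mapping.keys f. scale (Poly_Mapping.lookup f w) (eval_monomial mult \<phi> w))"

definition star_identities ::
  "('k::field \<Rightarrow> 'a::ab_group_add \<Rightarrow> 'a) \<Rightarrow> ('a \<Rightarrow> 'a \<Rightarrow> 'a) \<Rightarrow> ('a \<Rightarrow> 'a)
    \<Rightarrow> 'k free_algebra set" where
  "star_identities scale mult star =
     {f. \<forall>a b. (\<forall>i. a i \<in> symmetric_elements star) \<and> (\<forall>j. b j \<in> skew_elements star) \<longrightarrow>
           eval_poly scale mult (case_gen a b) f = 0}"

definition multilinear_monomials :: "nat \<Rightarrow> nat \<Rightarrow> gen monomial set" where
  "multilinear_monomials k l =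
     {w. distinct (factors w) \<and> set (factors w) = Sym ` {..<k} \<union> Skew ` {..<l}}"

definition multilinear_polys :: "nat \<Rightarrow> nat \<Rightarrow> 'k::field free_algebra set" where
  "multilinear_polys k l = {f. Poly_Mapping.keys f \<subseteq> multilinear_monomials k l}"

definition partial_star_codimension ::
  "('k::field \<Rightarrow> 'a::ab_group_add \<Rightarrow> 'a) \<Rightarrow> ('a \<Rightarrow> 'a \<Rightarrow> 'a) \<Rightarrow> ('a \<Rightarrow> 'a)
    \<Rightarrow> nat \<Rightarrow> nat \<Rightarrow> nat" where
  "partial_star_codimension scale mult star k l =
     vector_space.quotient_dim (free_scale :: 'k \<Rightarrow> _)
       (multilinear_polys k l) (multilinear_polys k l \<inter> star_identities scale mult star)"

definition star_codimension ::
  "('k::field \<Rightarrow> 'a::ab_group_add \<Rightarrow> 'a) \<Rightarrow> ('a \<Rightarrow> 'a \<Rightarrow> 'a) \<Rightarrow> ('a \<Rightarrow> 'a) \<Rightarrow> nat \<Rightarrow> nat" where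
  "star_codimension scale mult star n =
     (\<Sum>k = 0..n. (n choose k) * partial_star_codimension scale mult star k (n - k))"

context algebra_with_involution
begin

lemma eval_poly_superset:
  assumes "finite S" "Poly_Mapping.keys f \<subseteq> S"
  shows "eval_poly scale mult \<phi> f =
    (\<Sum>w\<in>S. scale (Poly_Mapping.lookup f w) (eval_monomial mult \<phi> w))"
  unfolding eval_poly_def using assms
  by (intro sum.mono_neutral_left) (auto simp: in_keys_iff)

lemma eval_poly_add:
  "eval_poly scale mult \<phi> (f + g) = eval_poly scale mult \<phi> f + eval_poly scale mult \<phi> g"
proof -
  let ?S = "Poly_Mapping.keys f \<union> Poly_Mapping.keys g"
  have "Poly_Mapping.keys (f + g) \<subseteq> ?S" by (rule Poly_Mapping.keys_add)
  then show ?thesis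
    by (simp add: eval_poly_superset[of ?S] lookup_add scale_left_distrib sum.distrib)
qed

lemma eval_poly_scale:
  "eval_poly scale mult \<phi> (free_scale c f) = scale c (eval_poly scale mult \<phi> f)"
proof -
  have "Poly_Mapping.keys (free_scale c f) \<subseteq> Poly_Mapping.keys f" by (auto simp: in_keys_iff)
  then show ?thesis
    by (simp add: eval_poly_superset[of "Poly_Mapping.keys f"] scale_sum_right)
qed

lemma linear_eval_poly: "Vector_Spaces.linear free_scale scale (eval_poly scale mult \<phi>)"
proof -
  interpret F: vector_space "free_scale :: 'k \<Rightarrow> _" by (rule vector_space_free_scale)
  show ?thesis by unfold_locales (simp_all add: eval_poly_add eval_poly_scale)
qed

lemma eval_poly_single:
  "eval_poly scale mult \<phi> (Poly_Mapping.single w c) = scale c (eval_monomial mult \<phi> w)"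
  by (simp add: eval_poly_superset[of "{w}"])

lemma eval_poly_sum:
  "eval_poly scale mult \<phi> (\<Sum>i\<in>I. f i) = (\<Sum>i\<in>I. eval_poly scale mult \<phi> (f i))"
  by (induction I rule: infinite_finite_induct)
    (simp_all add: eval_poly_add eval_poly_def[of _ _ _ 0])

lemma eval_poly_mult:
  "eval_poly scale mult \<phi> (free_mult f g) =
     mult (eval_poly scale mult \<phi> f) (eval_poly scale mult \<phi> g)"
proof -
  interpret L: Vector_Spaces.linear scale scale "\<lambda>a. mult a b" for b by (rule linear_mult_left)
  interpret R: Vector_Spaces.linear scale scale "\<lambda>b. mult a b" for a by (rule linear_mult_right)
  show ?thesis
    unfolding free_mult_def eval_poly_sum eval_poly_single
    by (subst sum.swap)
      (simp add: eval_poly_def L.sum R.sum L.scale R.scale scale_sum_right mult.commute)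
qed

end

lemma finite_multilinear_monomials: "finite (multilinear_monomials k l)"
proof -
  have len: "length (factors w) \<ge> 1" for w :: "gen monomial" by (induction w) auto
  have fin: "finite {w :: gen monomial. set (factors w) \<subseteq> G \<and> length (factors w) \<le> n}"
    if G: "finite G" for G n
  proof (induction n)
    case 0
    have "{w :: gen monomial. set (factors w) \<subseteq> G \<and> length (factors w) \<le> 0} = {}"
      using len by (auto simp del: length_0_conv) (metis len not_one_le_zero list.size(3))
    then show ?case by (simp only: finite.emptyI)
  next
    case (Suc n)
    let ?M = "{w :: gen monomial. set (factors w) \<subseteq> G \<and> length (factors w) \<le> n}"
    have "{w :: gen monomial. set (factors w) \<subseteq> G \<and> length (factors w) \<le> Suc n}
        \<subseteq> Gen ` G \<union> (\<lambda>(s, t). Prod s t) ` (?M \<times> ?M)"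
    proof
      fix w :: "gen monomial"
      assume w: "w \<in> {w. set (factors w) \<subseteq> G \<and> length (factors w) \<le> Suc n}"
      show "w \<in> Gen ` G \<union> (\<lambda>(s, t). Prod s t) ` (?M \<times> ?M)"
      proof (cases w)
        case (Gen x) then show ?thesis using w by auto
      next
        case (Prod s t)
        then show ?thesis using w len[of s] len[of t] by auto
      qed
    qed
    then show ?case by (rule finite_subset) (use Suc G in simp)
  qed
  let ?G = "Sym ` {..<k} \<union> Skew ` {..<l}"
  have "multilinear_monomials k l
      \<subseteq> {w. set (factors w) \<subseteq> ?G \<and> length (factors w) \<le> card ?G}"
    by (auto simp: multilinear_monomials_def dest: distinct_card)
  then show ?thesis by (rule finite_subset) (simp add: fin)
qed

lemma (in algebra_with_involution) partial_star_codimension_plus_dim: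
  fixes k l :: nat
  defines "P \<equiv> multilinear_polys k l :: 'k free_algebra set"
  shows "partial_star_codimension scale mult star k l
      + vector_space.dim free_scale (P \<inter> star_identities scale mult star)
    = vector_space.dim free_scale P"
proof -
  interpret F: vector_space "free_scale :: 'k \<Rightarrow> _" by (rule vector_space_free_scale)
  have P: "F.subspace P"
    unfolding F.subspace_def P_def multilinear_polys_def
    by (auto simp: in_keys_iff subset_iff lookup_add) (metis add_0)
  have "F.subspace (star_identities scale mult star)"
    unfolding F.subspace_def star_identities_def
    by (auto simp: eval_poly_add eval_poly_scale eval_poly_def[of _ _ _ 0])
  then have W: "F.subspace (P \<inter> star_identities scale mult star)"
    using P by (rule F.subspace_inter[rotated])
  let ?F = "(\<lambda>w. Poly_Mapping.single w 1) ` multilinear_monomials k l"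
  have "P \<subseteq> F.span ?F"
  proof
    fix f assume f: "f \<in> P"
    have "f = (\<Sum>w\<in>Poly_Mapping.keys f.
        free_scale (Poly_Mapping.lookup f w) (Poly_Mapping.single w 1))"
      by (rule poly_mapping_eqI)
        (simp add: lookup_sum lookup_single in_keys_iff when_def if_distrib[of "(*) _"] cong: if_cong)
    also have "\<dots> \<in> F.span ?F"
      using f by (intro F.span_sum F.span_scale F.span_base) (auto simp: P_def multilinear_polys_def)
    finally show "f \<in> F.span ?F" .
  qed
  then show ?thesis
    unfolding partial_star_codimension_def P_def[symmetric]
    by (intro F.quotient_dim_plus_dim P W) (auto simp: finite_multilinear_monomials)
qed

end

theory Submission
  imports Defs "HOL-Library.FuncSet"
begin

text \<open>
  Let \<open>p\<close> and \<open>q\<close> be the dimensions of \<open>A\<^sup>+\<close> and \<open>A\<^sup>-\<close>. A multilinear polynomial in \<open>k\<close> symmetric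
  and \<open>l\<close> skew variables is an identity as soon as it vanishes when the variables run through
  bases of \<open>A\<^sup>+\<close> and \<open>A\<^sup>-\<close>. There are \<open>p\<^sup>k q\<^sup>l\<close> such substitutions and the value of each has \<open>d\<close>
  coordinates, so the identities are cut out by \<open>p\<^sup>k q\<^sup>l d\<close> linear functionals and have at most
  this codimension. Summing over \<open>k + l = n\<close> gives \<open>(p + q)\<^sup>n d\<close>, and \<open>p + q \<le> d\<close> because
  \<open>A\<^sup>+ \<inter> A\<^sup>- = 0\<close> in characteristic other than two.
\<close>

section \<open>Homogeneous linear systems and the dimension of a quotient\<close>

lemma underdetermined_system:
  fixes M :: "'j \<Rightarrow> 'v \<Rightarrow> 'k::field"
  assumes "finite J" "finite S" "card J < card S"
  shows "\<exists>u. (\<exists>v\<in>S. u v \<noteq> 0) \<and> (\<forall>j\<in>J. (\<Sum>v\<in>S. u v * M j v) = 0)"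
  using assms
proof (induction J arbitrary: S M rule: finite_induct)
  case empty
  then have "S \<noteq> {}" by auto
  then show ?case by (intro exI[of _ "\<lambda>_. 1"]) auto
next
  case (insert j J)
  show ?case
  proof (cases "\<forall>v\<in>S. M j v = 0")
    case True
    with insert show ?thesis using insert.IH[of S M] by auto
  next
    case False
    then obtain w where w: "w \<in> S" "M j w \<noteq> 0" by blast
    \<comment> \<open>Gaussian elimination with pivot \<open>M j w\<close>: equation
      \<open>j\<close> is solved for the unknown \<open>w\<close>, and \<open>?N\<close> holds the
      coefficients of the other equations after substituting that solution.\<close>
    let ?T = "S - {w}"
    let ?N = "\<lambda>i v. M i v - M i w * M j v / M j w"
    have "card J < card ?T" using insert w by simp
    then obtain u where u: "\<exists>v\<in>?T. u v \<noteq> 0" "\<forall>i\<in>J. (\<Sum>v\<in>?T. u v * ?N i v) = 0"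
      using insert.IH[of ?T ?N] insert.prems by auto
    define s where "s = (\<Sum>v\<in>?T. u v * M j v)"
    \<comment> \<open>Back substitution: equation \<open>j\<close> forces this value at
      \<open>w\<close>.\<close>
    let ?u = "u(w := - s / M j w)"
    have split: "(\<Sum>v\<in>S. ?u v * M i v) = - s / M j w * M i w + (\<Sum>v\<in>?T. u v * M i v)" for i
    proof -
      have "(\<Sum>v\<in>?T. ?u v * M i v) = (\<Sum>v\<in>?T. u v * M i v)"
        by (rule sum.cong) auto
      then show ?thesis using insert.prems w by (simp add: sum.remove[of S w])
    qed
    have "(\<Sum>v\<in>S. ?u v * M j v) = 0"
      unfolding split using w by (simp add: s_def)
    moreover have "(\<Sum>v\<in>S. ?u v * M i v) = 0" if "i \<in> J" for i
    proof -
      have "0 = (\<Sum>v\<in>?T. u v * M i v - M i w / M j w * (u v * M j v))"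
        using u(2) that by (simp add: algebra_simps)
      also have "\<dots> = (\<Sum>v\<in>?T. u v * M i v) - M i w / M j w * s"
        by (simp add: sum_subtractf sum_distrib_left s_def)
      finally show ?thesis unfolding split by simp
    qed
    moreover have "\<exists>v\<in>S. ?u v \<noteq> 0" using u(1) by auto
    ultimately show ?thesis by (intro exI[of _ ?u]) blast
  qed
qed

text \<open>With more representatives than functionals, some nontrivial combination of them is
  killed by every functional and so lies in \<open>W\<close>, contradicting independence modulo
  \<open>W\<close>.\<close>

lemma (in vector_space) quotient_dim_le_card_functionals:
  assumes V: "subspace V" and W: "subspace W" "W \<subseteq> V"
    and J: "finite J" "\<And>j. j \<in> J \<Longrightarrow> Vector_Spaces.linear scale (*) (l j)"
    and ker: "\<And>v. v \<in> V \<Longrightarrow> (\<And>j. j \<in> J \<Longrightarrow> l j v = 0) \<Longrightarrow> v \<in> W"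
  shows "quotient_dim V W \<le> card J"
proof -
  define B where "B = (SOME B. quotient_basis V W B)"
  have B: "quotient_basis V W B"
    unfolding B_def using quotient_basis_exists[OF V W] by (rule someI_ex)
  have small: "card S \<le> card J" if S: "S \<subseteq> B" "finite S" for S
  proof (rule ccontr)
    assume "\<not> card S \<le> card J"
    then obtain u where u: "\<exists>v\<in>S. u v \<noteq> 0" "\<forall>j\<in>J. (\<Sum>v\<in>S. u v * l j v) = 0"
      using underdetermined_system[OF J(1) S(2), of l] by auto
    have "l j (\<Sum>v\<in>S. u v *s v) = 0" if "j \<in> J" for j
    proof -
      interpret L: Vector_Spaces.linear scale "(*)" "l j" using J(2) that .
      show ?thesis using u(2) that by (simp add: L.sum L.scale)
    qed
    moreover have "(\<Sum>v\<in>S. u v *s v) \<in> V"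
      using S B by (intro subspace_sum[OF V] subspace_scale[OF V]) (auto simp: quotient_basis_def)
    ultimately have "(\<Sum>v\<in>S. u v *s v) \<in> W" using ker by blast
    with B S u(1) show False unfolding quotient_basis_def by blast
  qed
  \<comment> \<open>For infinite \<open>B\<close> the bound holds by the convention
    \<open>card B = 0\<close>.\<close>
  have "card B \<le> card J"
  proof (cases "finite B")
    case True
    then show ?thesis using small by blast
  qed simp
  then show ?thesis by (simp add: quotient_dim_def B_def)
qed

section \<open>Evaluation of multilinear polynomials\<close>

lemma subspace_multilinear_polys:
  "module.subspace free_scale (multilinear_polys k l :: 'k::field free_algebra set)"
proof -
  interpret F: vector_space "free_scale :: 'k \<Rightarrow> _" by (rule vector_space_free_scale)
  show ?thesis
    unfolding F.subspace_def multilinear_polys_def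
    by (auto simp: in_keys_iff subset_iff lookup_add) (metis add_0)
qed

lemma eval_monomial_cong:
  "(\<And>x. x \<in> set (factors w) \<Longrightarrow> \<phi> x = \<psi> x) \<Longrightarrow> eval_monomial mult \<phi> w = eval_monomial mult \<psi> w"
  by (induction w) auto

context algebra_with_involution
begin

lemma subspace_star_identities:
  "module.subspace free_scale (star_identities scale mult star)"
proof -
  interpret F: vector_space "free_scale :: 'k \<Rightarrow> _" by (rule vector_space_free_scale)
  show ?thesis
    unfolding F.subspace_def star_identities_def
    by (auto simp: eval_poly_add eval_poly_scale eval_poly_def[of _ _ _ 0])
qed

text \<open>In a product of monomials \<open>x\<close> occurs in exactly one factor. The other
  factor is constant in \<open>v\<close>, so linearity passes through multiplication by it on one
  side.\<close>

lemma linear_eval_monomial: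
  assumes "distinct (factors w)" "x \<in> set (factors w)"
  shows "Vector_Spaces.linear scale scale (\<lambda>v. eval_monomial mult (\<phi>(x := v)) w)"
  using assms
proof (induction w)
  case (Gen y)
  then show ?case by (simp add: linear_id[unfolded id_def])
next
  case (Prod s t)
  consider "x \<in> set (factors s)" "x \<notin> set (factors t)" | "x \<notin> set (factors s)" "x \<in> set (factors t)"
    using Prod.prems by auto
  then show ?case
  proof cases
    case 1
    then have "eval_monomial mult (\<phi>(x := v)) t = eval_monomial mult \<phi> t" for v
      by (intro eval_monomial_cong) auto
    then show ?thesis
      using Vector_Spaces.linear_compose[OF Prod.IH(1) linear_mult_left, of "eval_monomial mult \<phi> t"] 1 Prod.prems
      by (simp add: o_def del: fun_upd_apply)
  next
    case 2
    then have "eval_monomial mult (\<phi>(x := v)) s = eval_monomial mult \<phi> s" for v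
      by (intro eval_monomial_cong) auto
    then show ?thesis
      using Vector_Spaces.linear_compose[OF Prod.IH(2) linear_mult_right, of "eval_monomial mult \<phi> s"] 2 Prod.prems
      by (simp add: o_def del: fun_upd_apply)
  qed
qed

lemma eval_poly_cong:
  assumes "\<And>w x. w \<in> Poly_Mapping.keys f \<Longrightarrow> x \<in> set (factors w) \<Longrightarrow> \<phi> x = \<psi> x"
  shows "eval_poly scale mult \<phi> f = eval_poly scale mult \<psi> f"
  unfolding eval_poly_def using assms
  by (intro sum.cong refl arg_cong2[where f = scale] eval_monomial_cong) auto

text \<open>Phrased as a subspace so that vanishing on a set of values of one variable extends to
  its span by minimality.\<close>

lemma subspace_eval_poly_zero:
  assumes "f \<in> multilinear_polys k l" "x \<in> Sym ` {..<k} \<union> Skew ` {..<l}"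
  shows "subspace {v. eval_poly scale mult (\<phi>(x := v)) f = 0}"
proof -
  have lin: "Vector_Spaces.linear scale scale (\<lambda>v. eval_monomial mult (\<phi>(x := v)) w)"
    if "w \<in> Poly_Mapping.keys f" for w
    using assms that
    by (intro linear_eval_monomial) (auto simp: multilinear_polys_def multilinear_monomials_def)
  have add: "eval_poly scale mult (\<phi>(x := u + v)) f
      = eval_poly scale mult (\<phi>(x := u)) f + eval_poly scale mult (\<phi>(x := v)) f" for u v
    unfolding eval_poly_def sum.distrib[symmetric]
    by (rule sum.cong) (simp_all add: linear_iff[THEN iffD1, OF lin] scale_right_distrib)
  have mul: "eval_poly scale mult (\<phi>(x := scale c v)) f
      = scale c (eval_poly scale mult (\<phi>(x := v)) f)" for c v
    unfolding eval_poly_def scale_sum_right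
    by (rule sum.cong) (simp_all add: linear_iff[THEN iffD1, OF lin] scale_left_commute)
  have "eval_poly scale mult (\<phi>(x := 0)) f = 0" using mul[of 0 0] by simp
  then show ?thesis by (auto simp: subspace_def add mul)
qed

lemma eval_poly_zero_on_spans:
  fixes B :: "gen \<Rightarrow> 'a set"
  assumes f: "f \<in> multilinear_polys k l"
    and X: "X = Sym ` {..<k} \<union> Skew ` {..<l}"
    and zero: "\<And>\<phi>. \<phi> \<in> Pi\<^sub>E X B \<Longrightarrow> eval_poly scale mult \<phi> f = 0"
    and \<phi>: "\<And>x. x \<in> X \<Longrightarrow> \<phi> x \<in> span (B x)"
  shows "eval_poly scale mult \<phi> f = 0"
proof -
  \<comment> \<open>Generalized for induction: the variables in \<open>G\<close> already range over
    spans, the others still over the sets \<open>B x\<close>. Each step frees one more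
    variable.\<close>
  have "eval_poly scale mult \<phi> f = 0"
    if "finite G" "G \<subseteq> X" "\<And>x. x \<in> G \<Longrightarrow> \<phi> x \<in> span (B x)" "\<And>x. x \<in> X - G \<Longrightarrow> \<phi> x \<in> B x"
    for G \<phi>
    using that
  proof (induction G arbitrary: \<phi> rule: finite_induct)
    case empty
    \<comment> \<open>The hypothesis \<open>zero\<close> speaks of extensional assignments only;
      restricting to \<open>X\<close> is harmless because \<open>f\<close> involves no other
      variable.\<close>
    then have "eval_poly scale mult (restrict \<phi> X) f = 0" by (intro zero) auto
    moreover have "eval_poly scale mult (restrict \<phi> X) f = eval_poly scale mult \<phi> f"
      using f by (intro eval_poly_cong)
        (auto simp: X multilinear_polys_def multilinear_monomials_def)
    ultimately show ?case by simp
  next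
    case (insert x G)
    have "eval_poly scale mult (\<phi>(x := b)) f = 0" if "b \<in> B x" for b
      using insert that by (intro insert.IH) auto
    then have "span (B x) \<subseteq> {v. eval_poly scale mult (\<phi>(x := v)) f = 0}"
      using insert.prems by (intro span_minimal subspace_eval_poly_zero[OF f]) (auto simp: X)
    moreover have "\<phi> x \<in> span (B x)" using insert.prems by simp
    ultimately have "eval_poly scale mult (\<phi>(x := \<phi> x)) f = 0" by blast
    then show ?case by simp
  qed
  from this[of X \<phi>] \<phi> show ?thesis by (simp add: X)
qed

section \<open>Counting substitutions in the symmetric and skew subspaces\<close>

lemma subspace_symmetric_elements: "subspace (symmetric_elements star)"
  and subspace_skew_elements: "subspace (skew_elements star)"
  using linear_iff[THEN iffD1, OF linear_star] star_star
  by (auto simp: subspace_def symmetric_elements_def skew_elements_def) (metis scale_zero_left)+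

lemma partial_star_codimension_le:
  assumes "finite_dimensional_vector_space scale Basis"
  shows "partial_star_codimension scale mult star k l
    \<le> dim (symmetric_elements star) ^ k * dim (skew_elements star) ^ l * dim UNIV"
proof -
  interpret A: finite_dimensional_vector_space scale Basis by fact
  interpret F: vector_space "free_scale :: 'k \<Rightarrow> _" by (rule vector_space_free_scale)
  obtain P where P: "P \<subseteq> symmetric_elements star" "independent P"
      "symmetric_elements star \<subseteq> span P" "card P = dim (symmetric_elements star)"
    using basis_exists by blast
  obtain Q where Q: "Q \<subseteq> skew_elements star" "independent Q"
      "skew_elements star \<subseteq> span Q" "card Q = dim (skew_elements star)"
    using basis_exists by blast
  define X where "X = Sym ` {..<k} \<union> Skew ` {..<l}"
  define B where "B = case_gen (\<lambda>_. P) (\<lambda>_. Q)"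
  \<comment> \<open>One functional for each substitution of basis elements and each coordinate of
    the resulting value. Taking substitutions extensional on \<open>X\<close> makes them finite in
    number.\<close>
  define J where "J = Pi\<^sub>E X B \<times> Basis"
  have finB: "finite (B x)" for x
    using A.finiteI_independent P(2) Q(2) by (cases x) (auto simp: B_def)
  have "card (Pi\<^sub>E X B) = (\<Prod>x\<in>Sym ` {..<k}. card (B x)) * (\<Prod>x\<in>Skew ` {..<l}. card (B x))"
    unfolding X_def by (subst card_PiE) (auto intro: prod.union_disjoint)
  also have "\<dots> = card P ^ k * card Q ^ l"
    by (simp add: B_def prod.reindex inj_on_def)
  finally have cardJ: "card J = card P ^ k * card Q ^ l * dim UNIV"
    by (simp add: J_def card_cartesian_product A.dim_UNIV)
  let ?V = "multilinear_polys k l :: 'k free_algebra set"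
  let ?l = "\<lambda>(\<phi>, c) f. representation Basis (eval_poly scale mult \<phi> f) c"
  have "F.quotient_dim ?V (?V \<inter> star_identities scale mult star) \<le> card J"
  proof (rule F.quotient_dim_le_card_functionals[where l = ?l])
    show "F.subspace ?V" by (rule subspace_multilinear_polys)
    then show "F.subspace (?V \<inter> star_identities scale mult star)"
      using subspace_star_identities by (rule F.subspace_inter)
    show "finite J" unfolding J_def X_def using finB A.finite_Basis
      by (intro finite_cartesian_product finite_PiE) auto
    show "Vector_Spaces.linear free_scale (*) (?l j)" for j
    proof (cases j)
      case (Pair \<phi> c)
      interpret K: vector_space "(*) :: 'k \<Rightarrow> 'k \<Rightarrow> 'k"
        by unfold_locales (simp_all add: algebra_simps)
      show ?thesis unfolding Pair prod.case
        by unfold_locales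
          (simp_all add: eval_poly_add eval_poly_scale A.independent_Basis A.span_Basis
            representation_add representation_scale)
    qed
  next
    fix f assume f: "f \<in> ?V" and z: "\<And>j. j \<in> J \<Longrightarrow> ?l j f = 0"
    have "eval_poly scale mult \<phi> f = 0" if "\<phi> \<in> Pi\<^sub>E X B" for \<phi>
    proof -
      \<comment> \<open>For \<open>c\<close> in \<open>Basis\<close> this is the assumption on
        \<open>J\<close>; elsewhere \<open>representation\<close> is 0 by default.\<close>
      have "representation Basis (eval_poly scale mult \<phi> f) c = 0" for c
        using z[of "(\<phi>, c)"] that representation_ne_zero[of Basis _ c] by (auto simp: J_def)
      then show ?thesis
        using sum_nonzero_representation_eq[OF A.independent_Basis, of "eval_poly scale mult \<phi> f"]
        by (simp add: A.span_Basis)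
    qed
    then have "eval_poly scale mult \<phi> f = 0" if "\<And>x. x \<in> X \<Longrightarrow> \<phi> x \<in> span (B x)" for \<phi>
      using eval_poly_zero_on_spans[OF f X_def, of B] that by blast
    moreover have "case_gen a b x \<in> span (B x)"
      if "\<forall>i. a i \<in> symmetric_elements star" "\<forall>j. b j \<in> skew_elements star" for a b x
      using that P(3) Q(3) by (cases x) (auto simp: B_def)
    ultimately have "f \<in> star_identities scale mult star"
      by (simp add: star_identities_def)
    with f show "f \<in> ?V \<inter> star_identities scale mult star" by blast
  qed simp
  then show ?thesis
    by (simp add: partial_star_codimension_def cardJ P(4) Q(4))
qed

end

lemma dim_symmetric_plus_skew_le:
  fixes scale :: "'k::field_char_0 \<Rightarrow> 'a::ab_group_add \<Rightarrow> 'a"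
  assumes "algebra_with_involution scale mult star"
    and "finite_dimensional_vector_space scale Basis"
  shows "vector_space.dim scale (symmetric_elements star)
      + vector_space.dim scale (skew_elements star) \<le> vector_space.dim scale UNIV"
proof -
  interpret algebra_with_involution scale mult star by fact
  interpret A: finite_dimensional_vector_space scale Basis by fact
  have "symmetric_elements star \<inter> skew_elements star \<subseteq> {0}"
  proof
    fix a assume "a \<in> symmetric_elements star \<inter> skew_elements star"
    then have "star a = a" "star a = - a"
      unfolding symmetric_elements_def skew_elements_def by blast+
    then have "a = - a" by (rule trans[OF sym])
    then have "a + a = 0" by (rule eq_neg_iff_add_eq_0[THEN iffD1])
    moreover have "scale (1 + 1) a = a + a" by (simp only: scale_left_distrib scale_one)
    \<comment> \<open>The characteristic enters here: \<open>2\<close> is nonzero in the field, so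
      \<open>a\<close> must vanish.\<close>
    ultimately have "scale 2 a = 0" by (simp only: one_add_one)
    then show "a \<in> {0}" by simp
  qed
  then have "dim (symmetric_elements star \<inter> skew_elements star) = 0" by (simp add: A.dim_eq_0)
  \<comment> \<open>By the dimension formula, the dimensions of two subspaces with zero intersection
    add up to that of their sum.\<close>
  with A.dim_sums_Int[OF subspace_symmetric_elements subspace_skew_elements]
  have "dim (symmetric_elements star) + dim (skew_elements star)
      = dim {x + y |x y. x \<in> symmetric_elements star \<and> y \<in> skew_elements star}" by linarith
  also have "\<dots> \<le> dim UNIV" by (rule A.dim_subset) simp
  finally show ?thesis .
qed

theorem theoremA:
  fixes scale :: "'k::field_char_0 \<Rightarrow> 'a::ab_group_add \<Rightarrow> 'a"
    and mult :: "'a \<Rightarrow> 'a \<Rightarrow> 'a"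
    and star :: "'a \<Rightarrow> 'a"
    and Basis :: "'a set"
    and d n :: nat
  assumes "algebra_with_involution scale mult star"
    and "finite_dimensional_vector_space scale Basis"
    and "d = vector_space.dim scale (UNIV :: 'a set)"
    and "n \<ge> 1"
  shows "star_codimension scale mult star n \<le> d ^ (n + 1)"
proof -
  interpret algebra_with_involution scale mult star by fact
  let ?p = "dim (symmetric_elements star)" and ?q = "dim (skew_elements star)"
  have "star_codimension scale mult star n \<le> (\<Sum>k\<le>n. (n choose k) * (?p ^ k * ?q ^ (n - k) * d))"
    unfolding star_codimension_def assms(3) atLeast0AtMost
    by (intro sum_mono mult_le_mono2 partial_star_codimension_le[OF assms(2)])
  \<comment> \<open>The weights \<open>n choose k\<close> of the codimension are those of the
    binomial theorem.\<close>
  also have "\<dots> = (?p + ?q) ^ n * d"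
    by (simp add: binomial_ring sum_distrib_right mult.assoc)
  also have "\<dots> \<le> d ^ n * d"
    unfolding assms(3)
    by (intro mult_le_mono1 power_mono dim_symmetric_plus_skew_le[OF assms(1,2)]) simp
  finally show ?thesis by (simp add: mult.commute)
qed

end
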